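(* There exist constants $C>0$ and $n_0$ such that for every odd integer $n\ge n_0$ there is a dissection $D_n$ of the unit square $[0,1]^2$ into $n$ triangles with \[ \mathcal{R}(D_n)\le \frac{8n^4}{n^{\log_2 n}\,\log_2 n}\Bigl(1+C\frac{\log n}{n}\Bigr). \] In particular $\mathcal{R}(D_n)\le n^{-\log_2 n+O(1)}$, i.e. $\log(1/\mathcal{R}(D_n))=\Omega(\log^2 n)$.
   Context: A dissection of a polygon is a finite set of nondegenerate triangles with disjoint interiors whose union is the polygon. If its triangles have areas $a_1,\dots,a_n$, the range is $\mathcal{R}(D)=\max_{i,j}|a_i-a_j|$. *)

theory Defs
  imports "HOL-Analysis.Analysis"
begin

definition triangle :: "(real \<times> real) set \<Rightarrow> bool" where
  "triangle T \<longleftrightarrow> (\<exists>a b c. \<not> collinear {a, b, c} \<and> T = convex hull {a, b, c})"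

definition dissection :: "(real \<times> real) set set \<Rightarrow> (real \<times> real) set \<Rightarrow> bool" where
  "dissection D P \<longleftrightarrow> finite D \<and> (\<forall>T\<in>D. triangle T)
     \<and> (\<forall>S\<in>D. \<forall>T\<in>D. S \<noteq> T \<longrightarrow> interior S \<inter> interior T = {})
     \<and> \<Union>D = P"

definition area :: "(real \<times> real) set \<Rightarrow> real" where
  "area T = measure lebesgue T"

definition drange :: "(real \<times> real) set set \<Rightarrow> real" where
  "drange D = Max {\<bar>area S - area T\<bar> | S T. S \<in> D \<and> T \<in> D}"

definition unit_square :: "(real \<times> real) set" where
  "unit_square = {0..1} \<times> {0..1}"

end

theory Submission
  imports Defs
begin

text \<open>
  Cut the triangle with vertices \<open>(0,1)\<close>, \<open>(1,1)\<close>, \<open>(1,1-\<epsilon>)\<close>, \<open>\<epsilon> = 2/N\<close>, off the square and fill the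
  remaining trapezoid from left to right by a zigzag of \<open>N-1\<close> triangles of area \<open>1/N\<close>, each
  advancing either the bottom point \<open>(b,0)\<close> or the top point \<open>(t,1-\<epsilon>t)\<close>. With \<open>u = 1-\<epsilon>b\<close> and
  \<open>v = 1-\<epsilon>t\<close>, after \<open>m\<close> triangles \<open>uv = P m = 1-4m/N\<^sup>2\<close> whatever the choices were, and
  \<open>ln (u/v)\<close> is the signed sum of the increments of \<open>ln P\<close>, the sign of each step being the choice
  made there. The zigzag ends exactly on the right side iff this sum vanishes. For \<open>N = 2^k+1\<close> and the
  Thue-Morse signs the sum is a \<open>(k+1)\<close>-fold difference of \<open>ln P\<close>, hence at most about
  \<open>2^(k(k-1)/2) k! (4/N\<^sup>2)^(k+1)\<close>. Moving the last two points to the corners changes only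
  the last two areas, by about \<open>N\<close> times that amount. For other odd \<open>n\<close> take the largest
  \<open>N = 2^k+1 \<le> n\<close>, squeeze the square horizontally and fill the freed rectangle by pairs of
  triangles of area exactly \<open>1/n\<close>.
\<close>

subsection \<open>Triangles and dissections of the unit square\<close>

text \<open>Twice the signed area of the triangle \<open>p q r\<close>.\<close>

definition cross :: "real \<times> real \<Rightarrow> real \<times> real \<Rightarrow> real \<times> real \<Rightarrow> real" where
  "cross p q r = (fst q - fst p) * (snd r - snd p) - (fst r - fst p) * (snd q - snd p)"

text \<open>Linear inequalities on vertices extend to convex hulls, so disjointness of interiors
  becomes a finite check. They are weak because adjacent triangles share edges on the separating
  line.\<close>

definition separated :: "(real \<times> real) set \<Rightarrow> (real \<times> real) set \<Rightarrow> bool" where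
  "separated V W \<longleftrightarrow> (\<exists>\<alpha> \<beta> \<gamma>. (\<alpha>, \<beta>) \<noteq> (0, 0) \<and>
     (\<forall>p\<in>V. \<alpha> * fst p + \<beta> * snd p \<le> \<gamma>) \<and> (\<forall>p\<in>W. \<gamma> \<le> \<alpha> * fst p + \<beta> * snd p))"

lemma separatedI:
  assumes "(\<alpha>, \<beta>) \<noteq> (0, 0)" and "\<And>p. p \<in> V \<Longrightarrow> \<alpha> * fst p + \<beta> * snd p \<le> \<gamma>"
    and "\<And>p. p \<in> W \<Longrightarrow> \<gamma> \<le> \<alpha> * fst p + \<beta> * snd p"
  shows "separated V W"
  using assms unfolding separated_def by blast

section \<open>Lebesgue area of a plane triangle\<close>

definition vec_to_pair :: "real ^ 2 \<Rightarrow> real \<times> real" where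
  "vec_to_pair v = (v $ 1, v $ 2)"

lemma linear_vec_to_pair: "linear vec_to_pair"
  by (rule linearI) (auto simp: vec_to_pair_def)

lemma measurable_vec_to_pair: "vec_to_pair \<in> borel_measurable lborel"
proof -
  have "continuous_on UNIV vec_to_pair"
    using linear_vec_to_pair by (simp add: linear_continuous_on linear_conv_bounded_linear)
  then show ?thesis by (simp add: borel_measurable_continuous_onI)
qed

text \<open>Lebesgue measure is determined by its values on boxes, and the preimage of a box is the
  box with the same coordinates.\<close>

lemma lborel_eq_distr_vec_to_pair: "lborel = distr lborel borel vec_to_pair"
proof (rule lborel_eqI)
  fix l u :: "real \<times> real"
  assume le: "\<And>b. b \<in> Basis \<Longrightarrow> l \<bullet> b \<le> u \<bullet> b"
  have le1: "fst l \<le> fst u" and le2: "snd l \<le> snd u"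
    using le[of "(1, 0)"] le[of "(0, 1)"] by (auto simp: Basis_prod_def inner_prod_def)
  define l' u' :: "real ^ 2"
    where "l' = vector [fst l, snd l]" and "u' = vector [fst u, snd u]"
  have pre: "vec_to_pair -` box l u = box l' u'"
    by (auto simp: vec_to_pair_def box_def l'_def u'_def Basis_prod_def inner_prod_def
        Basis_vec_def inner_axis forall_2)
  have "emeasure (distr lborel borel vec_to_pair) (box l u) = emeasure lborel (box l' u')"
    using measurable_vec_to_pair by (simp add: emeasure_distr pre)
  also have "\<dots> = (\<Prod>b\<in>Basis. (u' - l') \<bullet> b)"
  proof (rule emeasure_lborel_box)
    fix b :: "real ^ 2" assume "b \<in> Basis"
    then obtain i where "b = axis i 1" by (auto simp: Basis_vec_def)
    then show "l' \<bullet> b \<le> u' \<bullet> b"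
      using exhaust_2[of i] le1 le2 by (auto simp: inner_axis l'_def u'_def)
  qed
  also have "(\<Prod>b\<in>Basis. (u' - l') \<bullet> b) = (fst u - fst l) * (snd u - snd l)"
  proof -
    have "(\<Prod>b\<in>(Basis :: (real ^ 2) set). (u' - l') \<bullet> b) = (\<Prod>i\<in>UNIV. (u' - l') $ i)"
    proof (rule prod.reindex_cong[of "\<lambda>i. axis i 1"])
      show "inj (\<lambda>i::2. axis i (1::real))" by (simp add: inj_def axis_eq_axis)
      show "Basis = range (\<lambda>i::2. axis i (1::real))" by (auto simp: Basis_vec_def)
    qed (simp add: inner_axis)
    then show ?thesis by (simp add: UNIV_2 l'_def u'_def)
  qed
  also have "(fst u - fst l) * (snd u - snd l) = (\<Prod>b\<in>Basis. (u - l) \<bullet> b)"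
    by (simp add: Basis_prod_def inner_prod_def image_Un prod.union_disjoint)
  finally show "emeasure (distr lborel borel vec_to_pair) (box l u) = (\<Prod>b\<in>Basis. (u - l) \<bullet> b)" .
qed simp

text \<open>\<open>content_triangle\<close> gives the area in \<open>real ^ 2\<close>; the
  measure-preserving bijection \<open>vec_to_pair\<close> carries it over to pairs.\<close>

lemma area_triangle: "area (convex hull {p, q, r}) = \<bar>cross p q r\<bar> / 2"
proof -
  define w :: "real \<times> real \<Rightarrow> real ^ 2" where "w p = vector [fst p, snd p]" for p
  have vw: "vec_to_pair (w p) = p" and wv: "w (vec_to_pair v) = v" for p v
    by (auto simp: w_def vec_to_pair_def vec_eq_iff forall_2)
  have cl: "closed (convex hull {p, q, r})"
    by (intro compact_imp_closed finite_imp_compact_convex_hull) auto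
  have "vec_to_pair ` (convex hull {w p, w q, w r}) = convex hull {p, q, r}"
    using convex_hull_linear_image[OF linear_vec_to_pair, of "{w p, w q, w r}"] by (simp add: vw)
  then have pre: "vec_to_pair -` (convex hull {p, q, r}) = convex hull {w p, w q, w r}"
    using wv by (metis inj_on_inverseI inj_vimage_image_eq)
  have "area (convex hull {p, q, r}) = measure lborel (convex hull {p, q, r})"
    using cl by (simp add: area_def)
  also have "\<dots> = measure (distr lborel borel vec_to_pair) (convex hull {p, q, r})"
    using lborel_eq_distr_vec_to_pair by simp
  also have "\<dots> = measure lborel (convex hull {w p, w q, w r})"
    using measurable_vec_to_pair cl by (subst measure_distr) (auto simp: pre)
  also have "\<dots> = \<bar>cross p q r\<bar> / 2"
    by (simp add: content_triangle cross_def w_def abs_minus_commute algebra_simps)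
  finally show ?thesis .
qed

section \<open>Disjoint interiors and covering of the square\<close>

lemma cross_nonzero_imp_not_collinear:
  assumes "cross p q r \<noteq> 0"
  shows "\<not> collinear {p, q, r}"
proof
  assume "collinear {p, q, r}"
  then obtain u where u: "\<And>x y. x \<in> {p, q, r} \<Longrightarrow> y \<in> {p, q, r} \<Longrightarrow> \<exists>c. x - y = c *\<^sub>R u"
    unfolding collinear_def by blast
  obtain c d where "q - p = c *\<^sub>R u" "r - p = d *\<^sub>R u" using u[of q p] u[of r p] by auto
  then have "fst q - fst p = c * fst u" "snd q - snd p = c * snd u"
    "fst r - fst p = d * fst u" "snd r - snd p = d * snd u"
    by (simp_all add: prod_eq_iff)
  then show False using assms by (simp add: cross_def)
qed

text \<open>The interior of a closed half-plane with nonzero normal is the open half-plane, and the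
  two open sides of a line are disjoint.\<close>

lemma separated_interior_disjoint:
  assumes "separated V W"
  shows "interior (convex hull V) \<inter> interior (convex hull W) = {}"
proof -
  obtain \<alpha> \<beta> \<gamma> where nz: "(\<alpha>, \<beta>) \<noteq> (0, 0)"
    and V: "\<forall>p\<in>V. \<alpha> * fst p + \<beta> * snd p \<le> \<gamma>" and W: "\<forall>p\<in>W. \<gamma> \<le> \<alpha> * fst p + \<beta> * snd p"
    using assms unfolding separated_def by blast
  have "convex hull V \<subseteq> {x. (\<alpha>, \<beta>) \<bullet> x \<le> \<gamma>}"
    using V by (intro hull_minimal convex_halfspace_le) (auto simp: inner_prod_def)
  moreover have "convex hull W \<subseteq> {x. (\<alpha>, \<beta>) \<bullet> x \<ge> \<gamma>}"
    using W by (intro hull_minimal convex_halfspace_ge) (auto simp: inner_prod_def)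
  ultimately have "interior (convex hull V) \<subseteq> interior {x. (\<alpha>, \<beta>) \<bullet> x \<le> \<gamma>}"
    "interior (convex hull W) \<subseteq> interior {x. (\<alpha>, \<beta>) \<bullet> x \<ge> \<gamma>}"
    by (simp_all only: interior_mono)
  then have "interior (convex hull V) \<subseteq> {x. (\<alpha>, \<beta>) \<bullet> x < \<gamma>}"
    "interior (convex hull W) \<subseteq> {x. (\<alpha>, \<beta>) \<bullet> x > \<gamma>}"
    using nz by (simp_all only: interior_halfspace_le interior_halfspace_ge zero_prod_def not_False_eq_True)
  then show ?thesis by fastforce
qed

lemma area_unit_square: "area unit_square = 1"
proof -
  have sq: "unit_square = cbox (0, 0) (1, 1)" by (auto simp: unit_square_def cbox_Pair_eq)
  have "area unit_square = measure lborel (cbox (0::real, 0::real) (1, 1))"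
    unfolding area_def sq by (rule measure_completion) simp
  then show ?thesis by (simp add: content_Pair)
qed

text \<open>The union is closed and of full measure, so it misses no open subset of the square.\<close>

lemma Union_eq_unit_squareI:
  assumes fin: "finite D"
    and compact: "\<And>T. T \<in> D \<Longrightarrow> compact T" and convex: "\<And>T. T \<in> D \<Longrightarrow> convex T"
    and sub: "\<And>T. T \<in> D \<Longrightarrow> T \<subseteq> unit_square"
    and disj: "\<And>S T. S \<in> D \<Longrightarrow> T \<in> D \<Longrightarrow> S \<noteq> T \<Longrightarrow> interior S \<inter> interior T = {}"
    and total: "(\<Sum>T\<in>D. area T) = 1"
  shows "\<Union>D = unit_square"
proof
  show "\<Union>D \<subseteq> unit_square" using sub by blast
  have sq: "unit_square = cbox (0, 0) (1, 1)" by (auto simp: unit_square_def cbox_Pair_eq)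
  have cU: "compact (\<Union>D)" using fin compact by blast
  have "pairwise (\<lambda>S T. negligible (S \<inter> T)) D"
    using disj convex by (auto simp: pairwise_def negligible_convex_interior convex_Int)
  then have "measure lebesgue (\<Union>D) = 1"
    using total fin compact
    by (subst measure_negligible_finite_Union) (auto simp: area_def lmeasurable_compact)
  moreover have "measure lebesgue (unit_square - \<Union>D)
      = measure lebesgue unit_square - measure lebesgue (\<Union>D)"
    using sub cU by (intro measurable_measure_Diff) (auto simp: sq lmeasurable_compact fmeasurableD)
  ultimately have "measure lebesgue (unit_square - \<Union>D) = 0"
    using area_unit_square by (simp add: area_def)
  moreover have "unit_square - \<Union>D \<in> lmeasurable"
    using cU by (intro fmeasurable.Diff) (auto simp: sq lmeasurable_compact)
  ultimately have "negligible (unit_square - \<Union>D)"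
    by (simp add: negligible_iff_measure)
  then have "negligible (box (0, 0) (1, 1) - \<Union>D)"
    by (rule negligible_subset) (use box_subset_cbox sq in blast)
  moreover have "open (box (0, 0) (1, 1) - \<Union>D)"
    using cU by (intro open_Diff open_box compact_imp_closed)
  ultimately have "box (0, 0) (1, 1) \<subseteq> \<Union>D"
    using open_not_negligible by blast
  then have "closure (box (0, 0) (1, 1)) \<subseteq> \<Union>D"
    using cU by (intro closure_minimal compact_imp_closed)
  moreover have "box (0, 0) (1, 1) \<noteq> ({} :: (real \<times> real) set)"
    by (auto simp: box_ne_empty Basis_prod_def inner_prod_def)
  ultimately show "unit_square \<subseteq> \<Union>D" by (simp add: sq)
qed

section \<open>Dissections given by vertex data\<close>

text \<open>Covering is encoded by total area 1, so that every condition is algebraic in the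
  vertices.\<close>

definition near_equidissection ::
    "nat \<Rightarrow> real \<Rightarrow> (nat \<Rightarrow> real \<times> real) \<Rightarrow> (nat \<Rightarrow> real \<times> real) \<Rightarrow> (nat \<Rightarrow> real \<times> real) \<Rightarrow> bool"
  where "near_equidissection n \<eta> A B C \<longleftrightarrow>
     (\<forall>i<n. {A i, B i, C i} \<subseteq> unit_square) \<and>
     (\<forall>i<n. cross (A i) (B i) (C i) \<noteq> 0) \<and>
     (\<forall>i<n. \<bar>\<bar>cross (A i) (B i) (C i)\<bar> / 2 - 1 / real n\<bar> \<le> \<eta>) \<and>
     (\<forall>j<n. \<forall>i<j. separated {A i, B i, C i} {A j, B j, C j}) \<and>
     (\<Sum>i<n. \<bar>cross (A i) (B i) (C i)\<bar> / 2) = 1"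

text \<open>Disjoint nonempty interiors make distinct indices give distinct triangles, whence
  \<open>card D = n\<close>. Total area 1 yields the covering, and two areas within
  \<open>\<eta>\<close> of the same mean differ by at most \<open>2 * \<eta>\<close>.\<close>

lemma near_equidissection_imp_dissection:
  assumes "near_equidissection n \<eta> A B C"
  shows "\<exists>D. dissection D unit_square \<and> card D = n \<and> drange D \<le> 2 * \<eta>"
proof -
  have sub: "\<And>i. i < n \<Longrightarrow> {A i, B i, C i} \<subseteq> unit_square"
    and nz: "\<And>i. i < n \<Longrightarrow> cross (A i) (B i) (C i) \<noteq> 0"
    and near: "\<And>i. i < n \<Longrightarrow> \<bar>\<bar>cross (A i) (B i) (C i)\<bar> / 2 - 1 / real n\<bar> \<le> \<eta>"
    and sep: "\<And>i j. j < n \<Longrightarrow> i < j \<Longrightarrow> separated {A i, B i, C i} {A j, B j, C j}"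
    and total: "(\<Sum>i<n. \<bar>cross (A i) (B i) (C i)\<bar> / 2) = 1"
    using assms by (simp_all add: near_equidissection_def)
  define T where "T i = convex hull {A i, B i, C i}" for i
  define D where "D = T ` {..<n}"
  have areaT: "area (T i) = \<bar>cross (A i) (B i) (C i)\<bar> / 2" for i
    by (simp add: T_def area_triangle)
  have disj: "interior (T i) \<inter> interior (T j) = {}" if "i < n" "j < n" "i \<noteq> j" for i j
    using separated_interior_disjoint[OF sep, of j i] separated_interior_disjoint[OF sep, of i j] that
    by (cases "i < j") (auto simp: T_def)
  have int: "interior (T i) \<noteq> {}" if "i < n" for i
  proof
    assume "interior (T i) = {}"
    then have "negligible (T i)" by (simp add: T_def negligible_convex_interior)
    then show False using areaT[of i] nz[OF that] by (simp add: area_def negligible_imp_measure0)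
  qed
  have inj: "inj_on T {..<n}"
  proof (rule inj_onI, rule ccontr)
    fix i j assume "i \<in> {..<n}" "j \<in> {..<n}" "T i = T j" "i \<noteq> j"
    then show False using disj[of i j] int[of i] by simp
  qed
  have "(\<Sum>S\<in>D. area S) = 1"
    unfolding D_def by (subst sum.reindex[OF inj]) (use total in \<open>simp add: areaT\<close>)
  moreover have disj_D: "interior S \<inter> interior S' = {}" if "S \<in> D" "S' \<in> D" "S \<noteq> S'" for S S'
    using that disj unfolding D_def by blast
  moreover have "S \<subseteq> unit_square" if S: "S \<in> D" for S
  proof -
    obtain i where "i < n" "S = convex hull {A i, B i, C i}"
      using S unfolding D_def T_def by blast
    moreover have "convex unit_square" by (simp add: unit_square_def convex_Times)
    ultimately show ?thesis using sub[of i] by (simp add: hull_minimal)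
  qed
  moreover have "compact S" "convex S" if "S \<in> D" for S
    using that by (auto simp: D_def T_def finite_imp_compact_convex_hull)
  moreover have fin_D: "finite D" by (simp add: D_def)
  ultimately have Un: "\<Union>D = unit_square" by (intro Union_eq_unit_squareI)
  have triangle_D: "triangle S" if "S \<in> D" for S
    using that cross_nonzero_imp_not_collinear[OF nz] unfolding triangle_def D_def T_def by blast
  have "dissection D unit_square"
    unfolding dissection_def using Un fin_D disj_D by (blast dest: triangle_D)
  moreover have "card D = n" by (simp add: D_def card_image[OF inj])
  moreover have "drange D \<le> 2 * \<eta>"
  proof -
    have n: "n > 0" using total by (cases n) auto
    have eq: "{\<bar>area S - area S'\<bar> | S S'. S \<in> D \<and> S' \<in> D}
        = (\<lambda>(S, S'). \<bar>area S - area S'\<bar>) ` (D \<times> D)" by auto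
    have "\<bar>area (T i) - area (T j)\<bar> \<le> 2 * \<eta>" if "i < n" "j < n" for i j
      using near[OF that(1)] near[OF that(2)] by (simp add: areaT)
    then show ?thesis
      unfolding drange_def eq using n by (subst Max_le_iff) (auto simp: D_def)
  qed
  ultimately show ?thesis by blast
qed

text \<open>Squeezing the square horizontally frees a rectangle of area \<open>2 / (n + 2)\<close>, whose diagonal
  cuts it into two triangles of the exact mean area.\<close>

lemma near_equidissection_add_2:
  assumes "near_equidissection n \<eta> A B C"
  shows "\<exists>A' B' C'. near_equidissection (n + 2) \<eta> A' B' C'"
proof -
  have sub: "\<And>i. i < n \<Longrightarrow> {A i, B i, C i} \<subseteq> unit_square"
    and nz: "\<And>i. i < n \<Longrightarrow> cross (A i) (B i) (C i) \<noteq> 0"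
    and near: "\<And>i. i < n \<Longrightarrow> \<bar>\<bar>cross (A i) (B i) (C i)\<bar> / 2 - 1 / real n\<bar> \<le> \<eta>"
    and sep: "\<And>i j. j < n \<Longrightarrow> i < j \<Longrightarrow> separated {A i, B i, C i} {A j, B j, C j}"
    and total: "(\<Sum>i<n. \<bar>cross (A i) (B i) (C i)\<bar> / 2) = 1"
    using assms by (simp_all add: near_equidissection_def)
  have n: "n > 0" using total by (cases n) auto
  have \<eta>: "\<eta> \<ge> 0" using near[OF n] by linarith
  \<comment> \<open>Scaling areas by \<open>c\<close> sends the mean \<open>1 / n\<close> to
    \<open>1 / (n + 2)\<close> and shrinks deviations; the strip right of \<open>x = c\<close> has
    area \<open>2 / (n + 2)\<close>.\<close>
  define c where "c = real n / (real n + 2)"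
  have c: "0 < c" "c < 1" using n by (auto simp: c_def)
  define sq where "sq p = (c * fst p, snd p)" for p :: "real \<times> real"
  define A' where "A' i = (if i < n then sq (A i) else if i = n then (c, 0) else (1, 0))" for i
  define B' where "B' i = (if i < n then sq (B i) else if i = n then (1, 0) else (1, 1))" for i
  define C' where "C' i = (if i < n then sq (C i) else (c, 1))" for i
  have cross_sq: "cross (sq p) (sq q) (sq r) = c * cross p q r" for p q r
    by (simp add: cross_def sq_def algebra_simps)
  have cross_old: "\<bar>cross (A' i) (B' i) (C' i)\<bar> / 2 = c * (\<bar>cross (A i) (B i) (C i)\<bar> / 2)"
    if "i < n" for i
    using that c by (simp add: A'_def B'_def C'_def cross_sq abs_mult)
  have cross_new: "cross (A' i) (B' i) (C' i) = 1 - c" if "\<not> i < n" for i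
    using that by (simp add: A'_def B'_def C'_def cross_def)
  have half: "(1 - c) / 2 = 1 / real (n + 2)"
    by (simp add: c_def field_simps)
  have in_sq: "sq p \<in> unit_square \<and> fst (sq p) \<le> c" if "p \<in> unit_square" for p
    using that c by (auto simp: sq_def unit_square_def mult_le_one mult_left_le)
  have "{A' i, B' i, C' i} \<subseteq> unit_square" if "i < n + 2" for i
    using in_sq[of "A i"] in_sq[of "B i"] in_sq[of "C i"] sub[of i] c
    by (cases "i < n") (auto simp: A'_def B'_def C'_def unit_square_def)
  moreover have "cross (A' i) (B' i) (C' i) \<noteq> 0" for i
    using nz[of i] cross_new[of i] c
    by (cases "i < n") (auto simp: A'_def B'_def C'_def cross_sq)
  moreover have "\<bar>\<bar>cross (A' i) (B' i) (C' i)\<bar> / 2 - 1 / real (n + 2)\<bar> \<le> \<eta>" for i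
  proof (cases "i < n")
    case True
    have "\<bar>cross (A' i) (B' i) (C' i)\<bar> / 2 - 1 / real (n + 2)
        = c * (\<bar>cross (A i) (B i) (C i)\<bar> / 2 - 1 / real n)"
      unfolding cross_old[OF True] right_diff_distrib using n by (simp add: c_def)
    then have "\<bar>\<bar>cross (A' i) (B' i) (C' i)\<bar> / 2 - 1 / real (n + 2)\<bar>
        = c * \<bar>\<bar>cross (A i) (B i) (C i)\<bar> / 2 - 1 / real n\<bar>"
      using c by (simp add: abs_mult)
    also have "\<dots> \<le> 1 * \<eta>" using near[OF True] c \<eta> by (intro mult_mono) auto
    finally show ?thesis by simp
  next
    case False
    have "\<bar>cross (A' i) (B' i) (C' i)\<bar> / 2 = 1 / real (n + 2)"
      unfolding cross_new[OF False] half[symmetric] using c by simp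
    then show ?thesis using \<eta> by (simp only: diff_self abs_zero)
  qed
  moreover have "separated {A' i, B' i, C' i} {A' j, B' j, C' j}" if ij: "j < n + 2" "i < j" for i j
  proof -
    consider "j < n" | "i < n" "n \<le> j" | "i = n" "j = n + 1" using ij by linarith
    then show ?thesis
    proof cases
      case 1
      obtain \<alpha> \<beta> \<gamma> where s: "(\<alpha>, \<beta>) \<noteq> (0, 0)"
        "\<forall>p\<in>{A i, B i, C i}. \<alpha> * fst p + \<beta> * snd p \<le> \<gamma>"
        "\<forall>p\<in>{A j, B j, C j}. \<gamma> \<le> \<alpha> * fst p + \<beta> * snd p"
        using sep[OF 1 ij(2)] unfolding separated_def by blast
      have "i < n" using 1 ij by simp
      \<comment> \<open>The squeeze turns the old separating line into one with first coefficient
        \<open>\<alpha> / c\<close>.\<close>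
      show ?thesis
        by (rule separatedI[of "\<alpha> / c" \<beta> _ \<gamma>])
          (use s c 1 \<open>i < n\<close> in \<open>auto simp: A'_def B'_def C'_def sq_def\<close>)
    next
      case 2
      then have "fst p \<le> c" if "p \<in> {A' i, B' i, C' i}" for p
        using that sub[of i] in_sq[of "A i"] in_sq[of "B i"] in_sq[of "C i"]
        by (auto simp: A'_def B'_def C'_def)
      moreover have "c \<le> fst p" if "p \<in> {A' j, B' j, C' j}" for p
        using that 2 c by (auto simp: A'_def B'_def C'_def)
      ultimately show ?thesis by (intro separatedI[of 1 0 _ c]) simp_all
    next
      case 3
      \<comment> \<open>The separating line is the diagonal of the strip, through
        \<open>(1, 0)\<close> and \<open>(c, 1)\<close>.\<close>
      show ?thesis
        by (rule separatedI[of 1 "1 - c" _ 1]) (use 3 c in \<open>auto simp: A'_def B'_def C'_def\<close>)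
    qed
  qed
  moreover have "(\<Sum>i<n + 2. \<bar>cross (A' i) (B' i) (C' i)\<bar> / 2) = 1"
  proof -
    have "(\<Sum>i<n + 2. \<bar>cross (A' i) (B' i) (C' i)\<bar> / 2)
        = (\<Sum>i<n. \<bar>cross (A' i) (B' i) (C' i)\<bar> / 2) + (1 - c)"
      using c by (simp add: cross_new)
    also have "(\<Sum>i<n. \<bar>cross (A' i) (B' i) (C' i)\<bar> / 2) = c"
      using total by (simp add: cross_old flip: sum_distrib_left del: times_divide_eq_right)
    finally show ?thesis by simp
  qed
  ultimately have "near_equidissection (n + 2) \<eta> A' B' C'"
    unfolding near_equidissection_def by simp
  then show ?thesis by blast
qed

subsection \<open>Thue-Morse sums\<close>

text \<open>The sign is -1 to the power of the binary digit sum of \<open>n\<close>.\<close>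

fun thue_morse :: "nat \<Rightarrow> real" where
  "thue_morse n = (if n = 0 then 1 else (-1) ^ (n mod 2) * thue_morse (n div 2))"

declare thue_morse.simps [simp del]

lemma thue_morse_0 [simp]: "thue_morse 0 = 1"
  by (simp add: thue_morse.simps)

lemma thue_morse_double: "thue_morse (2 * m) = thue_morse m"
  by (cases "m = 0") (simp_all add: thue_morse.simps[of "2 * m"])

lemma thue_morse_Suc_double: "thue_morse (Suc (2 * m)) = - thue_morse m"
  by (simp add: thue_morse.simps[of "Suc (2 * m)"])

lemma thue_morse_cases: "thue_morse n = 1 \<or> thue_morse n = - 1"
proof (induction n rule: less_induct)
  case (less n)
  show ?case
  proof (cases "n = 0")
    case False
    then show ?thesis
      using less.IH[of "n div 2"] by (cases "even n") (auto simp: thue_morse.simps[of n])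
  qed simp
qed

text \<open>A new leading digit flips the parity of the digit sum; the induction strips the lowest
  digit.\<close>

lemma thue_morse_add_power2: "m < 2 ^ k \<Longrightarrow> thue_morse (2 ^ k + m) = - thue_morse m"
proof (induction k arbitrary: m)
  case 0
  then show ?case using thue_morse_Suc_double[of 0] by simp
next
  case (Suc k)
  have lt: "m div 2 < 2 ^ k" using Suc.prems by (simp add: less_mult_imp_div_less mult.commute)
  show ?case
  proof (cases "even m")
    case True
    then obtain l where m: "m = 2 * l" by (elim evenE)
    have "2 ^ Suc k + m = 2 * (2 ^ k + l)" using m by simp
    then show ?thesis
      using Suc.IH[OF lt] m by (simp only: thue_morse_double) simp
  next
    case False
    then obtain l where m: "m = Suc (2 * l)" by (metis oddE Suc_eq_plus1)
    have "2 ^ Suc k + m = Suc (2 * (2 ^ k + l))" using m by simp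
    then show ?thesis
      using Suc.IH[OF lt] m by (simp only: thue_morse_Suc_double) simp
  qed
qed

text \<open>Splitting the sum into halves exhibits it as a difference with step \<open>2 ^ k\<close> of a sum of the
  same shape, so \<open>k\<close> applications of the mean value theorem give a \<open>k\<close>-th derivative.\<close>

lemma thue_morse_sum_bound:
  fixes g :: "nat \<Rightarrow> real \<Rightarrow> real"
  assumes "\<And>j y. a \<le> y \<Longrightarrow> y \<le> b \<Longrightarrow> (g j has_real_derivative g (Suc j) y) (at y)"
    and "\<And>y. a \<le> y \<Longrightarrow> y \<le> b \<Longrightarrow> \<bar>g k y\<bar> \<le> K"
    and "a \<le> x" "x + 2 ^ k - 1 \<le> b"
  shows "\<bar>\<Sum>m<2 ^ k. thue_morse m * g 0 (x + real m)\<bar> \<le> (\<Prod>i<k. 2 ^ i) * K"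
  using assms
proof (induction k arbitrary: g x)
  case 0
  then show ?case by simp
next
  case (Suc k)
  \<comment> \<open>The lower half of the sum is \<open>F 0 x\<close>, the upper half
    \<open>- F 0 (x + 2 ^ k)\<close>. The derivative \<open>F 1\<close> has the same shape, so the
    induction hypothesis applies to it with \<open>g\<close> shifted by one derivative.\<close>
  define F where "F j y = (\<Sum>m<2 ^ k. thue_morse m * g j (y + real m))" for j y
  have deriv: "(F 0 has_real_derivative F 1 y) (at y)" if "x \<le> y" "y \<le> x + 2 ^ k" for y
    unfolding F_def
  proof (intro DERIV_sum DERIV_cmult)
    fix m :: nat assume "m \<in> {..<2 ^ k}"
    then have "real m \<le> 2 ^ k - 1" by (simp add: Suc_le_eq[symmetric] le_diff_eq flip: of_nat_le_iff[where 'a=real])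
    then have "(g 0 has_real_derivative g 1 (y + real m)) (at (y + real m))"
      using that Suc.prems(1)[of "y + real m" 0] Suc.prems(3,4) by simp
    then show "((\<lambda>y. g 0 (y + real m)) has_real_derivative g 1 (y + real m)) (at y)"
      by (simp add: DERIV_shift)
  qed
  obtain z where z: "x < z" "z < x + 2 ^ k" "F 0 (x + 2 ^ k) - F 0 x = 2 ^ k * F 1 z"
    using MVT2[of x "x + 2 ^ k" "F 0" "F 1"] deriv by auto
  have "(\<Sum>m<2 ^ Suc k. thue_morse m * g 0 (x + real m))
      = F 0 x + (\<Sum>m\<in>{2 ^ k..<2 ^ k + 2 ^ k}. thue_morse m * g 0 (x + real m))"
    unfolding F_def lessThan_atLeast0 by (simp add: sum.atLeastLessThan_concat mult_2)
  also have "(\<Sum>m\<in>{2 ^ k..<2 ^ k + 2 ^ k}. thue_morse m * g 0 (x + real m))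
      = (\<Sum>m<2 ^ k. thue_morse (2 ^ k + m) * g 0 (x + real (2 ^ k + m)))"
    using sum.shift_bounds_nat_ivl[of "\<lambda>m. thue_morse m * g 0 (x + real m)" 0 "2 ^ k" "2 ^ k"]
    by (simp add: lessThan_atLeast0 add.commute)
  also have "\<dots> = - F 0 (x + 2 ^ k)"
    unfolding F_def sum_negf[symmetric]
    by (intro sum.cong refl) (simp add: thue_morse_add_power2 add.assoc)
  also have "F 0 x + - F 0 (x + 2 ^ k) = - (2 ^ k * F 1 z)" using z(3) by linarith
  finally have "\<bar>\<Sum>m<2 ^ Suc k. thue_morse m * g 0 (x + real m)\<bar> = 2 ^ k * \<bar>F 1 z\<bar>"
    by (simp only: abs_minus_cancel abs_mult power_abs abs_numeral)
  also have "\<bar>F 1 z\<bar> \<le> (\<Prod>i<k. 2 ^ i) * K"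
    unfolding F_def One_nat_def
    by (rule Suc.IH[of "\<lambda>j. g (Suc j)"]) (use Suc.prems z in auto)
  finally show ?case by (simp add: mult.assoc mult.left_commute)
qed

text \<open>The summand is itself a difference with step 1 of \<open>ln (c - 4 * y)\<close>. One
  further mean value step therefore leads to the derivative of order \<open>k + 1\<close>, and
  \<open>d\<close> bounds its denominator from below.\<close>

lemma thue_morse_sum_ln_bound:
  fixes c d :: real
  assumes d: "0 < d" "d \<le> c - 4 * 2 ^ k"
  shows "\<bar>\<Sum>m<2 ^ k. thue_morse m * (ln (c - 4 * (real m + 1)) - ln (c - 4 * real m))\<bar>
    \<le> (\<Prod>i<k. 2 ^ i) * (fact k * 4 ^ Suc k / d ^ Suc k)"
proof -
  \<comment> \<open>\<open>G j\<close> is the \<open>j\<close>-th derivative of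
    \<open>ln (c - 4 * y)\<close> in closed form.\<close>
  define G :: "nat \<Rightarrow> real \<Rightarrow> real" where "G j y = (case j of 0 \<Rightarrow> ln (c - 4 * y)
    | Suc i \<Rightarrow> - (fact i * 4 ^ Suc i / (c - 4 * y) ^ Suc i))" for j y
  have pos: "d \<le> c - 4 * y" if "y \<le> 2 ^ k" for y using that d by linarith
  have G: "(G j has_real_derivative G (Suc j) y) (at y)" if "y \<le> 2 ^ k" for j y
  proof (cases j)
    case 0
    then show ?thesis
      using pos[OF that] d(1) unfolding G_def by (auto intro!: derivative_eq_intros)
  next
    case (Suc i)
    define w where "w = c - 4 * y"
    have "w > 0" using pos[OF that] d(1) by (simp add: w_def)
    have "((\<lambda>y. (c - 4 * y) ^ Suc i) has_real_derivative - 4 * (real (Suc i) * w ^ i)) (at y)"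
    proof -
      have "((\<lambda>y. c - 4 * y) has_real_derivative - 4) (at y)"
        by (auto intro!: derivative_eq_intros)
      from DERIV_power[OF this, of "Suc i"] show ?thesis by (simp add: w_def algebra_simps)
    qed
    then have "((\<lambda>y. inverse ((c - 4 * y) ^ Suc i)) has_real_derivative
        - (inverse (w ^ Suc i) * (- 4 * (real (Suc i) * w ^ i)) * inverse (w ^ Suc i))) (at y)"
      using \<open>w > 0\<close> unfolding w_def by (intro DERIV_inverse') auto
    then have "((\<lambda>y. - (fact i * 4 ^ Suc i) * inverse ((c - 4 * y) ^ Suc i)) has_real_derivative
        - (fact i * 4 ^ Suc i) *
        - (inverse (w ^ Suc i) * (- 4 * (real (Suc i) * w ^ i)) * inverse (w ^ Suc i))) (at y)"
      by (rule DERIV_cmult)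
    moreover have "- (fact i * 4 ^ Suc i) *
        - (inverse (w ^ Suc i) * (- 4 * (real (Suc i) * w ^ i)) * inverse (w ^ Suc i))
        = - (fact (Suc i) * 4 ^ Suc (Suc i) / w ^ Suc (Suc i))"
      using \<open>w > 0\<close> by (simp add: field_simps)
    moreover have "G (Suc j) y = - (fact (Suc i) * 4 ^ Suc (Suc i) / w ^ Suc (Suc i))"
      by (simp add: G_def Suc w_def)
    moreover have "G j = (\<lambda>y. - (fact i * 4 ^ Suc i) * inverse ((c - 4 * y) ^ Suc i))"
      by (auto simp: G_def Suc divide_inverse)
    ultimately show ?thesis by (simp only:)
  qed
  define g where "g j y = G j (y + 1) - G j y" for j y
  have "\<bar>\<Sum>m<2 ^ k. thue_morse m * g 0 (0 + real m)\<bar>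
    \<le> (\<Prod>i<k. 2 ^ i) * (fact k * 4 ^ Suc k / d ^ Suc k)"
  proof (rule thue_morse_sum_bound)
    show "(g j has_real_derivative g (Suc j) y) (at y)" if "0 \<le> y" "y \<le> 2 ^ k - 1" for j y
      unfolding g_def using G[of y j] G[of "y + 1" j] that
      by (intro DERIV_diff) (auto simp: DERIV_shift)
    show "\<bar>g k y\<bar> \<le> fact k * 4 ^ Suc k / d ^ Suc k" if y: "0 \<le> y" "y \<le> 2 ^ k - 1" for y
    proof -
      obtain z where z: "y < z" "z < y + 1" "G k (y + 1) - G k y = (y + 1 - y) * G (Suc k) z"
        using MVT2[of y "y + 1" "G k" "G (Suc k)", OF _ G] y by auto
      have "d \<le> c - 4 * z" using z y by (intro pos) linarith
      then have "fact k * 4 ^ Suc k / (c - 4 * z) ^ Suc k \<le> fact k * 4 ^ Suc k / d ^ Suc k"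
        using d by (intro divide_left_mono power_mono mult_pos_pos zero_less_power) auto
      moreover have "\<bar>g k y\<bar> = fact k * 4 ^ Suc k / (c - 4 * z) ^ Suc k"
        using z \<open>d \<le> c - 4 * z\<close> d by (simp add: g_def G_def abs_mult)
      ultimately show ?thesis by simp
    qed
  qed auto
  then show ?thesis by (simp add: g_def G_def)
qed

section \<open>Numerical size of the Thue-Morse error\<close>

text \<open>The product is \<open>2 ^ (k * (k - 1) / 2)\<close>; this form avoids the halved
  exponent.\<close>

lemma prod_power2_squared: "(\<Prod>i<k. 2 ^ i :: real)\<^sup>2 * 2 ^ k = 2 ^ (k * k)"
  by (induction k) (simp_all add: power2_eq_square power_add algebra_simps)

text \<open>From \<open>k = 3\<close> on, the new factor \<open>k + 2\<close> on the left is at most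
  the new factor \<open>2 ^ k\<close> on the right. The bound trades \<open>fact k\<close> for one
  copy of the product over \<open>k + 1\<close>, the source of the logarithm in the
  denominator.\<close>

lemma fact_Suc_le_prod_power2: "fact (Suc k) \<le> 4 * (\<Prod>i<k. 2 ^ i :: real)"
proof (cases "k < 3")
  case True
  then consider "k = 0" | "k = 1" | "k = 2" by linarith
  then show ?thesis by cases (simp_all add: fact_numeral numeral_2_eq_2)
next
  case False
  then have "3 \<le> k" by simp
  then show ?thesis
  proof (induction k rule: nat_induct_at_least)
    case base
    then show ?case by (simp add: numeral_3_eq_3)
  next
    case (Suc k)
    have "k + 2 \<le> (2 :: nat) ^ k" using Suc.hyps
      by (induction k rule: nat_induct_at_least) auto
    then have "real (k + 2) \<le> 2 ^ k" by (metis of_nat_le_iff of_nat_power of_nat_numeral)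
    then have "real (k + 2) * fact (Suc k) \<le> 2 ^ k * (4 * (\<Prod>i<k. 2 ^ i))"
      using Suc.IH by (intro mult_mono) auto
    then show ?case by (simp add: algebra_simps)
  qed
qed

text \<open>The preceding estimate with \<open>N = 2 ^ k + 1\<close> and
  \<open>d = (N - 2)\<^sup>2\<close>, multiplied by \<open>N / 2\<close>, which converts an error in
  logarithms into a displacement along the sides.\<close>

lemma thue_morse_error_bound:
  assumes "1 \<le> k"
  shows "(2 ^ k + 1) / 2 * ((\<Prod>i<k. 2 ^ i) * (fact k * 4 ^ Suc k / ((2 ^ k - 1)\<^sup>2) ^ Suc k))
    \<le> 2 ^ (2 * k + 6) / (2 ^ (k * k) * (real k + 1))"
proof -
  define p :: real where "p = (\<Prod>i<k. 2 ^ i)"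
  define q :: real where "q = 2 ^ k"
  have p: "p > 0" by (simp add: p_def prod_pos)
  have q: "q \<ge> 2" using power_increasing[OF assms, of "2::real"] by (simp add: q_def)
  \<comment> \<open>Replacing \<open>q - 1\<close> by \<open>q / 2\<close> costs
    \<open>4 ^ Suc k\<close>, so the numerator becomes
    \<open>16 ^ Suc k = 16 * q ^ 4\<close>.\<close>
  have "q\<^sup>2 / 4 \<le> (q - 1)\<^sup>2"
    using power_mono[of "q / 2" "q - 1" 2] q by (simp add: power_divide)
  then have "4 ^ Suc k / ((q - 1)\<^sup>2) ^ Suc k \<le> 4 ^ Suc k / (q\<^sup>2 / 4) ^ Suc k"
    using q by (intro divide_left_mono power_mono mult_pos_pos zero_less_power) auto
  also have "\<dots> = 16 ^ Suc k / (q\<^sup>2) ^ Suc k"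
    by (simp add: power_divide power_mult_distrib[symmetric] del: power_Suc)
  also have "(16::real) ^ Suc k = 16 * q ^ 4"
    by (simp add: q_def power_mult[symmetric] mult.commute[of k]) (simp add: power_mult)
  also have "(q\<^sup>2) ^ Suc k = q\<^sup>2 * (p\<^sup>2 * q)\<^sup>2"
    unfolding p_def q_def prod_power2_squared
    by (simp add: power_mult[symmetric] power_add[symmetric] algebra_simps)
  finally have "(q + 1) / 2 * (p * (fact k * (4 ^ Suc k / ((q - 1)\<^sup>2) ^ Suc k)))
      \<le> q * (p * (fact k * (16 * q ^ 4 / (q\<^sup>2 * (p\<^sup>2 * q)\<^sup>2))))"
    using p q by (intro mult_mono) auto
  also have "\<dots> = 16 * q * fact k / p ^ 3"
    using p q by (simp add: field_simps power_numeral_reduce)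
  also have "\<dots> \<le> 16 * q * (4 * p / (real k + 1)) / p ^ 3"
  proof -
    have "fact k \<le> 4 * p / (real k + 1)"
      using fact_Suc_le_prod_power2[of k] by (simp add: p_def field_simps)
    then show ?thesis using p q by (intro divide_right_mono mult_left_mono) auto
  qed
  also have "\<dots> = 64 * q\<^sup>2 / (p\<^sup>2 * q * (real k + 1))"
    using p q by (simp add: divide_simps power_numeral_reduce)
  also have "\<dots> = 2 ^ (2 * k + 6) / (2 ^ (k * k) * (real k + 1))"
    unfolding p_def q_def prod_power2_squared by (simp add: power_add power_mult[symmetric] mult.commute)
  finally show ?thesis by (simp add: p_def q_def)
qed

subsection \<open>Zigzag dissections\<close>

text \<open>\<open>\<phi> m\<close> is twice the area of the part of the trapezoid to the left of the segment from
  \<open>(b m, 0)\<close> to \<open>(t m, 1 - \<epsilon> * t m)\<close>; that segment separates the earlier triangles from the later ones.\<close>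

lemma near_equidissection_zigzag:
  fixes b t :: "nat \<Rightarrow> real" and M :: nat
  defines "\<epsilon> \<equiv> 2 / (real M + 1)"
  defines "\<phi> \<equiv> \<lambda>m. b m + t m - \<epsilon> * b m * t m"
  assumes M: "2 \<le> M"
    and start: "b 0 = 0" "t 0 = 0" and stop: "b M = 1" "t M = 1"
    and move: "\<And>m. m < M \<Longrightarrow> b m < b (Suc m) \<and> t (Suc m) = t m \<or> t m < t (Suc m) \<and> b (Suc m) = b m"
    and near: "\<And>m. m < M \<Longrightarrow> \<bar>(\<phi> (Suc m) - \<phi> m) / 2 - 1 / (real M + 1)\<bar> \<le> \<eta>"
  shows "\<exists>A B C. near_equidissection (Suc M) \<eta> A B C"
proof -
  have \<epsilon>: "0 < \<epsilon>" "\<epsilon> < 1" using M by (auto simp: \<epsilon>_def)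
  have "\<eta> \<ge> 0" using near[of 0] M by linarith
  define h where "h x = 1 - \<epsilon> * x" for x :: real
  have mono: "b i \<le> b j \<and> t i \<le> t j" if "i \<le> j" "j \<le> M" for i j
    using that
  proof (induction j rule: dec_induct)
    case (step m)
    then show ?case using move[of m] by fastforce
  qed simp
  have range: "0 \<le> b m" "b m \<le> 1" "0 \<le> t m" "t m \<le> 1" if "m \<le> M" for m
    using mono[of 0 m] mono[of m M] that start stop by auto
  have h_pos: "0 < h x" if "x \<le> 1" for x
  proof -
    have "\<epsilon> * x \<le> \<epsilon>" using that \<epsilon> by simp
    then show ?thesis using \<epsilon> unfolding h_def by linarith
  qed
  have h_le: "0 \<le> h x \<and> h x \<le> 1" if "0 \<le> x" "x \<le> 1" for x
    using h_pos[OF that(2)] \<epsilon> that by (simp add: h_def)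
  \<comment> \<open>For \<open>m < M\<close> the triangle has the current segment as a side and the
    advanced point as apex; index \<open>M\<close> is the corner triangle.\<close>
  define A :: "nat \<Rightarrow> real \<times> real" where "A m = (if m < M then (b m, 0) else (0, 1))" for m
  define B where "B m = (if m < M then (t m, h (t m)) else (1, 1 - \<epsilon>))" for m
  define C :: "nat \<Rightarrow> real \<times> real" where "C m = (if m < M then
      if b m < b (Suc m) then (b (Suc m), 0) else (t (Suc m), h (t (Suc m)))
    else (1, 1))" for m
  have cross: "cross (A m) (B m) (C m) = - (\<phi> (Suc m) - \<phi> m)" if "m < M" for m
    using move[OF that] that
    by (auto simp: A_def B_def C_def cross_def \<phi>_def h_def algebra_simps)
  have \<phi>_less: "\<phi> m < \<phi> (Suc m)" if "m < M" for m
    using move[OF that]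
  proof
    assume *: "b m < b (Suc m) \<and> t (Suc m) = t m"
    then have "0 < (b (Suc m) - b m) * h (t m)"
      using range[of m] that by (intro mult_pos_pos h_pos) auto
    then show ?thesis using * by (simp add: \<phi>_def h_def algebra_simps)
  next
    assume *: "t m < t (Suc m) \<and> b (Suc m) = b m"
    then have "0 < (t (Suc m) - t m) * h (b m)"
      using range[of m] that by (intro mult_pos_pos h_pos) auto
    then show ?thesis using * by (simp add: \<phi>_def h_def algebra_simps)
  qed
  have abs_cross: "\<bar>cross (A m) (B m) (C m)\<bar> = \<phi> (Suc m) - \<phi> m" if "m < M" for m
    using cross[OF that] \<phi>_less[OF that] by simp
  have top: "cross (A M) (B M) (C M) = \<epsilon>"
    by (simp add: A_def B_def C_def cross_def)
  have verts: "A m \<in> {(b m, 0)} \<and> B m \<in> {(t m, h (t m))} \<and>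
      C m \<in> {(b (Suc m), 0), (t (Suc m), h (t (Suc m)))}" if "m < M" for m
    using that by (simp add: A_def B_def C_def)
  have in_square: "{A i, B i, C i} \<subseteq> unit_square" if "i < Suc M" for i
  proof (cases "i < M")
    case True
    then show ?thesis
      using verts[OF True] range[of i] range[of "Suc i"] h_le[of "t i"] h_le[of "t (Suc i)"]
      by (auto simp: unit_square_def)
  next
    case False
    then show ?thesis using \<epsilon> by (simp add: A_def B_def C_def unit_square_def)
  qed
  moreover have "cross (A i) (B i) (C i) \<noteq> 0" if "i < Suc M" for i
    using that cross[of i] \<phi>_less[of i] top \<epsilon> by (cases "i = M") auto
  moreover have "\<bar>\<bar>cross (A i) (B i) (C i)\<bar> / 2 - 1 / real (Suc M)\<bar> \<le> \<eta>" if "i < Suc M" for i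
  proof (cases "i = M")
    case True
    then have "\<bar>cross (A i) (B i) (C i)\<bar> / 2 = 1 / real (Suc M)"
      unfolding True top abs_of_pos[OF \<epsilon>(1)] by (simp add: \<epsilon>_def divide_simps)
    then show ?thesis using \<open>\<eta> \<ge> 0\<close> by (simp only: diff_self abs_zero)
  next
    case False
    then show ?thesis using near[of i] abs_cross[of i] that by (simp add: add.commute)
  qed
  moreover have "separated {A i, B i, C i} {A j, B j, C j}" if ij: "j < Suc M" "i < j" for i j
  proof (cases "j = M")
    case True
    \<comment> \<open>The corner triangle is cut off by the slanted line
      \<open>\<epsilon> * x + y = 1\<close>.\<close>
    have below: "\<epsilon> * fst p + 1 * snd p \<le> 1" if "p \<in> {A i, B i, C i}" for p
      using that verts[of i] ij range[of i] range[of "Suc i"] \<epsilon>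
      by (auto simp: h_def mult_le_one)
    have above: "1 \<le> \<epsilon> * fst p + 1 * snd p" if "p \<in> {A j, B j, C j}" for p
      using that True \<epsilon> by (auto simp: A_def B_def C_def)
    show ?thesis by (rule separatedI[OF _ below above]) (use \<epsilon> in auto)
  next
    case False
    \<comment> \<open>The separating line is the one through both end points just after triangle
      \<open>i\<close>. By \<open>at_top\<close>, a point of the slanted side is on the side decided
      by comparing its abscissa with \<open>t m\<close>; on the bottom the comparison is with
      \<open>b m\<close>.\<close>
    define m where "m = Suc i"
    have m: "m \<le> j" "j < M" "m \<le> M" "i < M" using ij False by (auto simp: m_def)
    define \<alpha> where "\<alpha> = h (t m)"
    define \<beta> where "\<beta> = - (t m - b m)"
    have \<alpha>: "\<alpha> > 0" unfolding \<alpha>_def using range[OF m(3)] by (intro h_pos)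
    have hb: "h (b m) > 0" using range[OF m(3)] by (intro h_pos)
    have at_top: "\<alpha> * x + \<beta> * h x - b m * \<alpha> = (x - t m) * h (b m)" for x
      by (simp add: \<alpha>_def \<beta>_def h_def algebra_simps)
    have left: "\<alpha> * fst p + \<beta> * snd p \<le> b m * \<alpha>" if "p \<in> {A i, B i, C i}" for p
    proof -
      have le: "b i \<le> b m" "t i \<le> t m" using mono[of i m] m by (auto simp: m_def)
      have "p \<in> {(b i, 0), (b m, 0), (t i, h (t i)), (t m, h (t m))}"
        using that verts[OF m(4)] by (auto simp: m_def)
      moreover have "(t i - t m) * h (b m) \<le> 0"
        using le hb by (simp add: mult_nonpos_nonneg)
      ultimately show ?thesis
        using le \<alpha> at_top[of "t i"] at_top[of "t m"] by auto
    qed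
    have right: "b m * \<alpha> \<le> \<alpha> * fst p + \<beta> * snd p" if "p \<in> {A j, B j, C j}" for p
    proof -
      have le: "b m \<le> b j" "t m \<le> t j" "b m \<le> b (Suc j)" "t m \<le> t (Suc j)"
        using mono[of m j] mono[of m "Suc j"] m by auto
      have "p \<in> {(b j, 0), (b (Suc j), 0), (t j, h (t j)), (t (Suc j), h (t (Suc j)))}"
        using that verts[OF m(2)] by auto
      moreover have "0 \<le> (t j - t m) * h (b m)" "0 \<le> (t (Suc j) - t m) * h (b m)"
        using le hb by simp_all
      ultimately show ?thesis
        using le \<alpha> at_top[of "t j"] at_top[of "t (Suc j)"] by auto
    qed
    show ?thesis by (rule separatedI[OF _ left right]) (use \<alpha> in auto)
  qed
  moreover have "(\<Sum>i<Suc M. \<bar>cross (A i) (B i) (C i)\<bar> / 2) = 1"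
  proof -
    have "(\<Sum>i<M. \<bar>cross (A i) (B i) (C i)\<bar> / 2) = (\<Sum>i<M. \<phi> (Suc i) - \<phi> i) / 2"
      by (simp add: abs_cross sum_divide_distrib)
    also have "(\<Sum>i<M. \<phi> (Suc i) - \<phi> i) = 2 - \<epsilon>"
      by (subst sum_lessThan_telescope) (simp add: \<phi>_def start stop)
    finally show ?thesis using top \<epsilon> by (simp add: field_simps)
  qed
  ultimately have "near_equidissection (Suc M) \<eta> A B C"
    unfolding near_equidissection_def by simp
  then show ?thesis by blast
qed

section \<open>The zigzag with Thue-Morse signs\<close>

lemma abs_exp_minus_one_le:
  fixes x :: real
  assumes "\<bar>x\<bar> \<le> 1"
  shows "\<bar>exp x - 1\<bar> \<le> 2 * \<bar>x\<bar>"
proof (cases "0 \<le> x")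
  case True
  then have "x\<^sup>2 \<le> x" using assms by (simp add: power2_eq_square mult_left_le)
  then show ?thesis using exp_bound[of x] True assms by simp
next
  case False
  then show ?thesis using exp_ge_add_one_self[of x] exp_le_one_iff[of x] by linarith
qed

lemma near_equidissection_thue_morse:
  assumes k: "5 \<le> k"
  shows "\<exists>A B C. near_equidissection (2 ^ k + 1)
    (2 ^ (2 * k + 6) / (2 ^ (k * k) * (real k + 1)) / 2) A B C"
proof -
  define M :: nat where "M = 2 ^ k"
  define N where "N = real M + 1"
  define \<epsilon> where "\<epsilon> = 2 / N"
  define E :: real where "E = 2 ^ (2 * k + 6) / (2 ^ (k * k) * (real k + 1))"
  have M32: "32 \<le> M" using power_increasing[OF k, of "2::nat"] by (simp add: M_def)
  have N: "N \<ge> 33" using M32 by (simp add: N_def)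
  have \<epsilon>: "0 < \<epsilon>" "\<epsilon> < 1" using N by (auto simp: \<epsilon>_def)
  have realM: "real M = 2 ^ k" by (simp add: M_def)
  \<comment> \<open>\<open>2 / N\<close> is the exact increment of doubled area per triangle, so an
    error below it cannot reverse a move.\<close>
  have E_less: "E < 2 / N"
  proof -
    have "2 * k + 6 + k \<le> k * k"
    proof -
      have "5 * k \<le> k * k" using k by simp
      then show ?thesis using k by linarith
    qed
    then have "(2::real) ^ (2 * k + 6) * 2 ^ k \<le> 2 ^ (k * k)"
      unfolding power_add[symmetric] by (rule power_increasing) simp
    then have "2 ^ (2 * k + 6) / 2 ^ (k * k) \<le> 1 / (2::real) ^ k"
      by (simp add: field_simps)
    then have "2 ^ (2 * k + 6) / 2 ^ (k * k) / (real k + 1) \<le> 1 / (2::real) ^ k / 1"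
      by (intro frac_le[of _ "_ / _"]) auto
    then have "E \<le> 1 / real M" by (simp add: E_def realM)
    also have "\<dots> < 2 / N" using M32 by (simp add: N_def field_simps)
    finally show ?thesis .
  qed
  \<comment> \<open>With \<open>\<phi> = 2 * m / N\<close>, this is \<open>1 - \<epsilon> * \<phi> =
    (1 - \<epsilon> * b) * (1 - \<epsilon> * t)\<close>. At \<open>m = M\<close> it is the value for
    \<open>b = t = 1\<close>.\<close>
  define P where "P m = 1 - 4 * real m / N\<^sup>2" for m
  have P_M: "P M = (1 - \<epsilon>)\<^sup>2"
  proof -
    have "real M = N - 1" by (simp add: N_def)
    then have "P M = (N\<^sup>2 - 4 * (N - 1)) / N\<^sup>2" using N by (simp add: P_def diff_divide_distrib)
    also have "N\<^sup>2 - 4 * (N - 1) = (N - 2)\<^sup>2" by (simp add: power2_eq_square algebra_simps)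
    also have "(N - 2)\<^sup>2 / N\<^sup>2 = (1 - \<epsilon>)\<^sup>2"
      using N by (simp add: \<epsilon>_def diff_divide_distrib flip: power_divide)
    finally show ?thesis .
  qed
  have P_less: "P (Suc m) < P m" for m
    using N by (simp add: P_def divide_strict_right_mono)
  have P_pos: "P m > 0" if "m \<le> M" for m
  proof -
    have "P M \<le> P m" using that N by (simp add: P_def divide_right_mono)
    moreover have "P M > 0" using \<epsilon> by (simp add: P_M)
    ultimately show ?thesis by linarith
  qed
  \<comment> \<open>The global sign is normalized so that the last move is of the bottom point and
    the one before it of the top point.\<close>
  define s where "s m = thue_morse (M - 1) * thue_morse m" for m
  have s_cases: "s m = 1 \<or> s m = - 1" for m
    using thue_morse_cases[of m] thue_morse_cases[of "M - 1"] by (auto simp: s_def)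
  have s_last: "s (M - 1) = 1" "s (M - 2) = - 1"
  proof -
    show "s (M - 1) = 1" using thue_morse_cases[of "M - 1"] by (auto simp: s_def)
    define l :: nat where "l = 2 ^ (k - 1) - 1"
    have "M = 2 ^ Suc (k - 1)" using k by (simp add: M_def)
    then have "M = 2 * Suc l" by (simp add: l_def)
    then have "M - 1 = Suc (2 * l)" "M - 2 = 2 * l" by auto
    then show "s (M - 2) = - 1"
      using thue_morse_cases[of l]
      by (auto simp: s_def thue_morse_double thue_morse_Suc_double)
  qed
  define \<sigma> where "\<sigma> m = (\<Sum>i<m. s i * (ln (P (Suc i)) - ln (P i)))" for m
  have \<sigma>_bound: "N / 2 * \<bar>\<sigma> M\<bar> \<le> E"
  proof -
    have "ln (P (Suc i)) - ln (P i) = ln (N\<^sup>2 - 4 * (real i + 1)) - ln (N\<^sup>2 - 4 * real i)"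
      if "i < M" for i
    proof -
      have "N\<^sup>2 - 4 * real m > 0 \<and> ln (P m) = ln (N\<^sup>2 - 4 * real m) - ln (N\<^sup>2)" if "m \<le> M" for m
      proof -
        have eq: "P m = (N\<^sup>2 - 4 * real m) / N\<^sup>2" using N by (simp add: P_def field_simps)
        then have "N\<^sup>2 - 4 * real m > 0" using P_pos[OF that] N by (simp add: zero_less_divide_iff)
        then show ?thesis using N by (simp add: eq ln_div)
      qed
      from this[of i] this[of "Suc i"] that show ?thesis by (simp add: add.commute)
    qed
    then have "\<sigma> M = thue_morse (M - 1) *
        (\<Sum>m<2 ^ k. thue_morse m * (ln (N\<^sup>2 - 4 * (real m + 1)) - ln (N\<^sup>2 - 4 * real m)))"
      unfolding \<sigma>_def s_def sum_distrib_left M_def[symmetric]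
      by (intro sum.cong refl) (simp add: mult.assoc)
    then have "\<bar>\<sigma> M\<bar> =
        \<bar>\<Sum>m<2 ^ k. thue_morse m * (ln (N\<^sup>2 - 4 * (real m + 1)) - ln (N\<^sup>2 - 4 * real m))\<bar>"
      using thue_morse_cases[of "M - 1"] by (auto simp: abs_mult)
    also have "\<dots> \<le> (\<Prod>i<k. 2 ^ i) * (fact k * 4 ^ Suc k / ((2 ^ k - 1)\<^sup>2) ^ Suc k)"
    proof (rule thue_morse_sum_ln_bound)
      have "(2::real) ^ k \<ge> 32" using M32 by (simp add: realM[symmetric])
      then show "(2 ^ k - 1 :: real)\<^sup>2 > 0" by (intro zero_less_power) simp
      show "(2 ^ k - 1)\<^sup>2 \<le> N\<^sup>2 - 4 * 2 ^ k"
        by (simp add: N_def realM power2_eq_square algebra_simps)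
    qed
    finally have "N / 2 * \<bar>\<sigma> M\<bar> \<le>
        N / 2 * ((\<Prod>i<k. 2 ^ i) * (fact k * 4 ^ Suc k / ((2 ^ k - 1)\<^sup>2) ^ Suc k))"
      using N by (intro mult_left_mono) auto
    also have "\<dots> \<le> E"
      using thue_morse_error_bound[of k] k by (simp add: E_def N_def realM)
    finally show ?thesis .
  qed
  \<comment> \<open>These solve \<open>u * v = P\<close> and \<open>ln (u / v) = \<sigma>\<close>. A
    sign of 1 makes the increment of \<open>\<sigma>\<close> equal that of \<open>ln P\<close>, so
    only \<open>u\<close> moves; a sign of -1 moves only \<open>v\<close>.\<close>
  define u where "u m = exp ((ln (P m) + \<sigma> m) / 2)" for m
  define v where "v m = exp ((ln (P m) - \<sigma> m) / 2)" for m
  have u_pos: "u m > 0" and v_pos: "v m > 0" for m by (simp_all add: u_def v_def)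
  have uv: "u m * v m = P m" if "m \<le> M" for m
    using P_pos[OF that] by (simp add: u_def v_def add_divide_distrib diff_divide_distrib flip: exp_add)
  have \<sigma>_Suc: "\<sigma> (Suc m) = \<sigma> m + s m * (ln (P (Suc m)) - ln (P m))" for m
    by (simp add: \<sigma>_def)
  have ln_less: "ln (P (Suc m)) < ln (P m)" if "m < M" for m
    using that P_less[of m] P_pos[of "Suc m"] P_pos[of m] by simp
  have plus: "u (Suc m) < u m \<and> v (Suc m) = v m" if "s m = 1" "m < M" for m
    using ln_less[OF that(2)] that(1) by (simp add: u_def v_def \<sigma>_Suc)
  have minus: "v (Suc m) < v m \<and> u (Suc m) = u m" if "s m = - 1" "m < M" for m
    using ln_less[OF that(2)] that(1) by (simp add: u_def v_def \<sigma>_Suc)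
  have u_le: "u m \<le> 1" if "m \<le> M" for m
    using that
  proof (induction m)
    case 0
    then show ?case by (simp add: u_def \<sigma>_def P_def)
  next
    case (Suc m)
    then show ?case using plus[of m] minus[of m] s_cases[of m] by fastforce
  qed
  define b0 where "b0 m = (1 - u m) / \<epsilon>" for m
  define t0 where "t0 m = (1 - v m) / \<epsilon>" for m
  have u_eq: "u m = 1 - \<epsilon> * b0 m" and v_eq: "v m = 1 - \<epsilon> * t0 m" for m
    using \<epsilon> by (simp_all add: b0_def t0_def)
  have \<phi>0: "b0 m + t0 m - \<epsilon> * b0 m * t0 m = 2 * real m / N" if "m \<le> M" for m
  proof -
    have "b0 m + t0 m - \<epsilon> * b0 m * t0 m = (1 - u m * v m) / \<epsilon>"
      using \<epsilon> by (simp add: u_eq v_eq field_simps)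
    also have "\<dots> = 2 * real m / N"
      using uv[OF that] N by (simp add: P_def \<epsilon>_def power2_eq_square field_simps)
    finally show ?thesis .
  qed
  have plus0: "b0 m < b0 (Suc m) \<and> t0 (Suc m) = t0 m" if "s m = 1" "m < M" for m
    using plus[OF that] \<epsilon> by (simp add: b0_def t0_def divide_strict_right_mono)
  have minus0: "t0 m < t0 (Suc m) \<and> b0 (Suc m) = b0 m" if "s m = - 1" "m < M" for m
    using minus[OF that] \<epsilon> by (simp add: b0_def t0_def divide_strict_right_mono)
  \<comment> \<open>The amount by which the top point misses the corner. Since
    \<open>v M = (1 - \<epsilon>) * exp (- \<sigma> M / 2)\<close>, it is at most
    \<open>\<bar>\<sigma> M\<bar> / \<epsilon>\<close>.\<close>
  define \<delta> where "\<delta> = 1 - t0 M"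
  have \<delta>: "\<bar>\<delta>\<bar> \<le> E"
  proof -
    have "\<bar>\<sigma> M\<bar> \<le> 1"
    proof -
      have "1 * \<bar>\<sigma> M\<bar> \<le> N / 2 * \<bar>\<sigma> M\<bar>" using N by (intro mult_right_mono) auto
      moreover have "2 / N \<le> 1" using N by simp
      ultimately show ?thesis using \<sigma>_bound E_less by linarith
    qed
    then have ex: "\<bar>exp (- \<sigma> M / 2) - 1\<bar> \<le> \<bar>\<sigma> M\<bar>"
      using abs_exp_minus_one_le[of "- \<sigma> M / 2"] by simp
    have "v M = exp (ln (1 - \<epsilon>) + - \<sigma> M / 2)"
      using \<epsilon> by (simp add: v_def P_M ln_realpow diff_divide_distrib)
    also have "\<dots> = (1 - \<epsilon>) * exp (- \<sigma> M / 2)"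
      unfolding exp_add using \<epsilon> by simp
    finally have "\<delta> = (1 - \<epsilon>) * (exp (- \<sigma> M / 2) - 1) / \<epsilon>"
      using \<epsilon> by (simp add: \<delta>_def t0_def field_simps)
    then have "\<bar>\<delta>\<bar> = (1 - \<epsilon>) * \<bar>exp (- \<sigma> M / 2) - 1\<bar> / \<epsilon>"
      using \<epsilon> by (simp add: abs_mult)
    also have "\<dots> \<le> 1 * \<bar>\<sigma> M\<bar> / \<epsilon>"
      using \<epsilon> ex by (intro divide_right_mono mult_mono) auto
    also have "\<dots> = N / 2 * \<bar>\<sigma> M\<bar>" by (simp add: \<epsilon>_def)
    finally show ?thesis using \<sigma>_bound by linarith
  qed
  \<comment> \<open>The last move leaves the top point fixed, so the top is corrected already at
    \<open>M - 1\<close>, the bottom only at \<open>M\<close>.\<close>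
  define b where "b m = (if m = M then 1 else b0 m)" for m
  define t where "t m = (if m = M \<or> m = M - 1 then 1 else t0 m)" for m
  define \<phi> where "\<phi> m = b m + t m - \<epsilon> * b m * t m" for m
  \<comment> \<open>Shifting the top by \<open>\<delta>\<close> changes \<open>\<phi>\<close> at
    \<open>M - 1\<close> by this amount. At \<open>M\<close> the corrected \<open>\<phi>\<close> is
    \<open>2 - \<epsilon> = 2 * M / N\<close>, so only the last two increments change.\<close>
  define \<kappa> where "\<kappa> = \<delta> * u (M - 1)"
  have Suc_M: "Suc (M - 2) = M - 1" "Suc (M - 1) = M" using M32 by auto
  have \<kappa>: "\<bar>\<kappa>\<bar> \<le> E"
  proof -
    have "\<bar>\<kappa>\<bar> \<le> \<bar>\<delta>\<bar> * 1"
      unfolding \<kappa>_def abs_mult using u_pos[of "M - 1"] u_le[of "M - 1"]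
      by (intro mult_left_mono) auto
    then show ?thesis using \<delta> by linarith
  qed
  have t0_last: "t0 (M - 1) = t0 M" and b0_last: "b0 (M - 1) = b0 (M - 2)"
    using plus0[OF s_last(1)] minus0[OF s_last(2)] M32 Suc_M by auto
  have \<phi>_eq: "\<phi> m = 2 * real m / N + (if m = M - 1 then \<kappa> else 0)" if "m \<le> M" for m
  proof -
    consider "m = M" | "m = M - 1" "m \<noteq> M" | "m \<noteq> M" "m \<noteq> M - 1" by blast
    then show ?thesis
    proof cases
      case 1
      then show ?thesis using N M32 by (simp add: \<phi>_def b_def t_def \<epsilon>_def N_def field_simps)
    next
      case 2
      have "\<phi> m = b0 m + t0 m - \<epsilon> * b0 m * t0 m + \<kappa>"
        using 2 t0_last by (simp add: \<phi>_def b_def t_def \<kappa>_def \<delta>_def u_eq algebra_simps)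
      then show ?thesis using \<phi>0[OF that] 2 by simp
    next
      case 3
      then show ?thesis using \<phi>0[OF that] by (simp add: \<phi>_def b_def t_def)
    qed
  qed
  have near: "\<bar>(\<phi> (Suc m) - \<phi> m) / 2 - 1 / N\<bar> \<le> E / 2" if "m < M" for m
  proof -
    have "2 * real (Suc m) / N - 2 * real m / N = 2 / N"
      by (simp add: diff_divide_distrib[symmetric])
    then have "\<bar>\<phi> (Suc m) - \<phi> m - 2 / N\<bar> \<le> \<bar>\<kappa>\<bar>"
      using \<phi>_eq[of m] \<phi>_eq[of "Suc m"] that by auto
    then have "\<bar>\<phi> (Suc m) - \<phi> m - 2 / N\<bar> \<le> E" using \<kappa> by linarith
    then show ?thesis by (simp add: abs_le_iff field_simps)
  qed
  have move: "b m < b (Suc m) \<and> t (Suc m) = t m \<or> t m < t (Suc m) \<and> b (Suc m) = b m"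
    if "m < M" for m
  proof -
    \<comment> \<open>For the last two moves this increment factors into the remaining distance
      times a positive height, so the corrected points still move right.\<close>
    have inc: "0 < \<phi> (Suc m) - \<phi> m" using near[OF that] E_less by (simp add: abs_le_iff field_simps)
    consider "m = M - 1" | "m = M - 2" | "Suc m \<noteq> M" "Suc m \<noteq> M - 1" "m \<noteq> M - 1"
      using that by linarith
    then show ?thesis
    proof cases
      case 1
      have vals: "b (Suc m) = 1" "t (Suc m) = 1" "b m = b0 m" "t m = 1"
        using 1 Suc_M that by (simp_all add: b_def t_def)
      then have "\<phi> (Suc m) - \<phi> m = (1 - b0 m) * (1 - \<epsilon>)"
        by (simp add: \<phi>_def algebra_simps)
      then have "b0 m < 1" using inc \<epsilon> by (simp add: zero_less_mult_iff)
      then show ?thesis using vals by simp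
    next
      case 2
      have ne: "M - 2 \<noteq> M - 1" "M - 2 \<noteq> M" "M - 1 \<noteq> M" using M32 by auto
      have vals: "b (Suc m) = b0 m" "t (Suc m) = 1" "b m = b0 m" "t m = t0 m"
        unfolding 2 Suc_M using ne b0_last by (simp_all add: b_def t_def)
      then have "\<phi> (Suc m) - \<phi> m = (1 - t0 m) * u m"
        by (simp add: \<phi>_def u_eq algebra_simps)
      then have "t0 m < 1" using inc u_pos[of m] by (simp add: zero_less_mult_iff)
      then show ?thesis using vals by simp
    next
      case 3
      then show ?thesis
        using plus0[of m] minus0[of m] s_cases[of m] that by (auto simp: b_def t_def)
    qed
  qed
  have "\<exists>A B C. near_equidissection (Suc M) (E / 2) A B C"
  proof (rule near_equidissection_zigzag)
    show "b 0 = 0" "t 0 = 0"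
      using M32 by (simp_all add: b_def t_def b0_def t0_def u_def v_def \<sigma>_def P_def)
    show "b M = 1" "t M = 1" by (simp_all add: b_def t_def)
    show "2 \<le> M" using M32 by simp
    fix m assume m: "m < M"
    show "b m < b (Suc m) \<and> t (Suc m) = t m \<or> t m < t (Suc m) \<and> b (Suc m) = b m"
      using move[OF m] .
    show "\<bar>(b (Suc m) + t (Suc m) - 2 / (real M + 1) * b (Suc m) * t (Suc m) -
        (b m + t m - 2 / (real M + 1) * b m * t m)) / 2 - 1 / (real M + 1)\<bar> \<le> E / 2"
      using near[OF m] by (simp only: \<phi>_def \<epsilon>_def N_def)
  qed
  then show ?thesis by (simp add: M_def E_def)
qed

section \<open>All odd numbers of triangles\<close>

lemma near_equidissection_add_even:
  assumes "\<exists>A B C. near_equidissection n \<eta> A B C"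
  shows "\<exists>A B C. near_equidissection (n + 2 * j) \<eta> A B C"
proof (induction j)
  case 0
  then show ?case using assms by simp
next
  case (Suc j)
  then obtain A B C where "near_equidissection (n + 2 * j) \<eta> A B C" by blast
  from near_equidissection_add_2[OF this] show ?case by simp
qed

text \<open>With \<open>L = log 2 n\<close> the exponents to compare are
  \<open>4 - (k - 1)\<^sup>2\<close> and \<open>4 - (L - 2)\<^sup>2\<close>. The worst case
  \<open>L = k + 1\<close> gives equality, also in the denominators.\<close>

lemma thue_morse_bound_le_powr_log:
  fixes n k :: nat
  assumes k: "2 ^ k \<le> n" "n < 2 ^ Suc k" "5 \<le> k"
  shows "2 ^ (2 * k + 6) / (2 ^ (k * k) * (real k + 1))
    \<le> 8 * real n ^ 4 / (real n powr log 2 (real n) * log 2 (real n))"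
proof -
  define L where "L = log 2 (real n)"
  have n: "real n > 0" using k(1) by (cases n) auto
  have L: "real k \<le> L" "L \<le> real k + 1"
  proof -
    have "real (2 ^ k) \<le> real n" using k(1) by (simp only: of_nat_le_iff)
    then have "2 powr real k \<le> real n" by (simp add: powr_realpow)
    then show "real k \<le> L" unfolding L_def using n by (simp add: le_log_iff)
    have "real n \<le> real (2 ^ Suc k)" using k(2) by (simp only: of_nat_le_iff less_imp_le)
    then have "real n \<le> 2 powr (real k + 1)" by (simp add: powr_add powr_realpow)
    then show "L \<le> real k + 1" unfolding L_def using n by (simp add: log_le_iff)
  qed
  have n_eq: "real n = 2 powr L" using n by (simp add: L_def)
  have "(L - 2)\<^sup>2 \<le> (real k - 1)\<^sup>2" using L k(3) by (intro power_mono) auto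
  then have exponent: "2 * real k + 3 - real k * real k \<le> 4 * L - L * L"
    by (simp add: power2_eq_square algebra_simps)
  have "2 ^ (2 * k + 6) / (2 ^ (k * k) * (real k + 1))
      = 8 * 2 powr (2 * real k + 3 - real k * real k) / (real k + 1)"
    by (simp add: powr_diff powr_add powr_realpow[symmetric] powr_numeral)
  also have "\<dots> \<le> 8 * 2 powr (4 * L - L * L) / L"
    using exponent L k(3) by (intro frac_le mult_left_mono) auto
  also have "\<dots> = 8 * real n ^ 4 / (real n powr L * L)"
    by (simp add: n_eq powr_powr powr_diff powr_power mult.commute)
  finally show ?thesis by (simp add: L_def)
qed

theorem theorem7p5:
  shows "\<exists>C::real. C > 0 \<and> (\<exists>n0::nat. \<forall>n::nat. n \<ge> n0 \<and> odd n \<longrightarrow>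
    (\<exists>D. dissection D unit_square \<and> card D = n \<and>
       drange D \<le> 8 * real n ^ 4 / (real n powr log 2 (real n) * log 2 (real n))
                   * (1 + C * ln (real n) / real n)))"
proof (rule exI[of _ 1], intro conjI, simp, rule exI[of _ 32], intro allI impI, elim conjE)
  fix n :: nat
  assume n: "32 \<le> n" "odd n"
  obtain k where k: "2 ^ k \<le> n" "n < 2 ^ (k + 1)"
    using ex_power_ivl1[of 2 n] n by auto
  have k5: "5 \<le> k"
  proof (rule ccontr)
    assume "\<not> 5 \<le> k"
    then have "(2::nat) ^ (k + 1) \<le> 2 ^ 5" by (intro power_increasing) auto
    then show False using k n by simp
  qed
  \<comment> \<open>As \<open>n\<close> is odd and \<open>2 ^ k\<close> even, \<open>n\<close>
    exceeds \<open>2 ^ k + 1\<close> by an even number, which pairs of triangles fill.\<close>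
  have "even ((2::nat) ^ k)" using k5 by simp
  moreover from this have "n \<noteq> 2 ^ k" using n(2) by blast
  ultimately have "2 ^ k + 1 \<le> n" "even (n - (2 ^ k + 1))" using n k by auto
  then obtain j where j: "n = 2 ^ k + 1 + 2 * j"
    by (metis evenE le_add_diff_inverse)
  define E :: real where "E = 2 ^ (2 * k + 6) / (2 ^ (k * k) * (real k + 1))"
  define R where "R = 8 * real n ^ 4 / (real n powr log 2 (real n) * log 2 (real n))"
  obtain A B C where "near_equidissection n (E / 2) A B C"
    using near_equidissection_add_even[OF near_equidissection_thue_morse[OF k5]] unfolding E_def j by blast
  from near_equidissection_imp_dissection[OF this]
  obtain D where D: "dissection D unit_square" "card D = n" "drange D \<le> E" by auto
  have "E \<le> R" unfolding E_def R_def using thue_morse_bound_le_powr_log k k5 by simp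
  \<comment> \<open>The factor with \<open>C = 1\<close> is at least 1 because \<open>ln n\<close>
    is nonnegative.\<close>
  moreover have "R * 1 \<le> R * (1 + 1 * ln (real n) / real n)"
    using n by (intro mult_left_mono) (auto simp: R_def)
  ultimately have "drange D \<le> R * (1 + 1 * ln (real n) / real n)" using D(3) by linarith
  then show "\<exists>D. dissection D unit_square \<and> card D = n \<and>
       drange D \<le> 8 * real n ^ 4 / (real n powr log 2 (real n) * log 2 (real n))
                   * (1 + 1 * ln (real n) / real n)"
    using D unfolding R_def by blast
qed

end
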